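(* Let $N\ge1$ and $0\le R\le N/10$ be integers, and let $\rho(R/N):=\frac12-\frac1{\mathrm{e}}-\frac{R}{N-2R}$. Then for the random walk on the binary cube with forbidden region, $$\kappa_N\ge\rho(R/N)\qquad\text{and}\qquad\kappa_\Sigma^c\le\frac{N}{\rho(R/N)}\cdot\left(1+\frac{R}{N-2R}\right).$$
   Context: Let $\Omega=\{x\in\{0,1\}^N:\sum_i x_i\ge R\}$ (the cube with the forbidden region $\{\sum_i x_i<R\}$ removed), with the Hamming distance $d(x,y)=\sum_{i=1}^N\mathbf{1}[x_i\neq y_i]$. The random walk on $\Omega$: from $x$, pick an index $I$ uniformly from $\{1,\ldots,N\}$; if $\sum_i x_i>R$, or if $\sum_i x_i=R$ and $x_I=0$, then $x_I$ is replaced with an independent Bernoulli(1/2) random variable; if $\sum_i x_i=R$ and $x_I=1$, the walk stays at $x$. With $P$ the kernel of this walk, $P^k_x$ the law after $k$ steps from $x$ ($P^0_x=\delta_x$), $W_1(\mu_1,\mu_2)=\inf\mathbb{E}(d(X,Y))$ over couplings $(X,Y)$ of $\mu_1,\mu_2$; $\kappa_k(x,y)=1-W_1(P^k_x,P^k_y)/d(x,y)$ for $x\ne y$, $\kappa_k(x,x)=1$, $\kappa_k=\inf_{x,y\in\Omega}\kappa_k(x,y)$, and $\kappa_\Sigma^c=\sum_{k=0}^\infty(1-\kappa_k)$. *)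

theory Defs
  imports "HOL-Probability.Probability"
begin

definition couplings :: "'a pmf \<Rightarrow> 'a pmf \<Rightarrow> ('a \<times> 'a) pmf set" where
  "couplings \<mu> \<nu> = {q. map_pmf fst q = \<mu> \<and> map_pmf snd q = \<nu>}"

(* Meant for bounded d, where every coupling has a genuine (integrable) expected distance. *)
definition wasserstein1 :: "('a \<Rightarrow> 'a \<Rightarrow> real) \<Rightarrow> 'a pmf \<Rightarrow> 'a pmf \<Rightarrow> real" where
  "wasserstein1 d \<mu> \<nu> =
     (INF q\<in>couplings \<mu> \<nu>. measure_pmf.expectation q (\<lambda>(x, y). d x y))"

primrec kernel_power :: "('a \<Rightarrow> 'a pmf) \<Rightarrow> nat \<Rightarrow> 'a \<Rightarrow> 'a pmf" where
  "kernel_power P 0 x = return_pmf x"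
| "kernel_power P (Suc k) x = bind_pmf (kernel_power P k x) P"

definition curvature_at ::
  "('a \<Rightarrow> 'a \<Rightarrow> real) \<Rightarrow> ('a \<Rightarrow> 'a pmf) \<Rightarrow> nat \<Rightarrow> 'a \<Rightarrow> 'a \<Rightarrow> real" where
  "curvature_at d P k x y =
     (if x = y then 1
      else 1 - wasserstein1 d (kernel_power P k x) (kernel_power P k y) / d x y)"

(* The infimum is a real number: below, S is a nonempty finite set. *)
definition curvature ::
  "'a set \<Rightarrow> ('a \<Rightarrow> 'a \<Rightarrow> real) \<Rightarrow> ('a \<Rightarrow> 'a pmf) \<Rightarrow> nat \<Rightarrow> real" where
  "curvature S d P k = (INF (x, y)\<in>S \<times> S. curvature_at d P k x y)"

(* The diagonal pairs give curvature at most 1, so the terms are nonnegative;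
   the series is taken in the extended reals and equals \<infinity> if it diverges. *)
definition cumulative_curvature_compl ::
  "'a set \<Rightarrow> ('a \<Rightarrow> 'a \<Rightarrow> real) \<Rightarrow> ('a \<Rightarrow> 'a pmf) \<Rightarrow> ereal" where
  "cumulative_curvature_compl S d P = (\<Sum>k. ereal (1 - curvature S d P k))"

(* {0,1}^N is the set of functions on {1..N} with values in {0,1}, extensional
   (i.e. undefined outside {1..N}), so that equality of states is equality of coordinates. *)
definition cube_states :: "nat \<Rightarrow> nat \<Rightarrow> (nat \<Rightarrow> nat) set" where
  "cube_states N R = {x \<in> {1..N} \<rightarrow>\<^sub>E {0, 1}. (\<Sum>i=1..N. x i) \<ge> R}"

definition hamming_dist :: "nat \<Rightarrow> (nat \<Rightarrow> nat) \<Rightarrow> (nat \<Rightarrow> nat) \<Rightarrow> real" where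
  "hamming_dist N x y = (\<Sum>i=1..N. of_bool (x i \<noteq> y i))"

(* On cube_states N R, the else branch is exactly the case where the coordinate sum is R
   and the chosen coordinate is 1. *)
definition cube_walk :: "nat \<Rightarrow> nat \<Rightarrow> (nat \<Rightarrow> nat) \<Rightarrow> (nat \<Rightarrow> nat) pmf" where
  "cube_walk N R x =
     bind_pmf (pmf_of_set {1..N}) (\<lambda>I.
       if (\<Sum>i=1..N. x i) > R \<or> ((\<Sum>i=1..N. x i) = R \<and> x I = 0)
       then map_pmf (\<lambda>b. x(I := of_bool b)) (bernoulli_pmf (1/2))
       else return_pmf x)"

abbreviation cube_curvature :: "nat \<Rightarrow> nat \<Rightarrow> nat \<Rightarrow> real" where
  "cube_curvature N R k \<equiv> curvature (cube_states N R) (hamming_dist N) (cube_walk N R) k"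

abbreviation cube_cumulative_curvature_compl :: "nat \<Rightarrow> nat \<Rightarrow> ereal" where
  "cube_cumulative_curvature_compl N R \<equiv>
     cumulative_curvature_compl (cube_states N R) (hamming_dist N) (cube_walk N R)"

(* Depends on N and R only through R/N. *)
definition rho :: "nat \<Rightarrow> nat \<Rightarrow> real" where
  "rho N R = 1/2 - 1 / exp 1 - real R / (real N - 2 * real R)"

end

theory Submission
  imports Defs
begin

text \<open>
  Driving all starting points by the same coordinates and bits is a coupling for which the expected
  distance after \<open>k\<close> steps satisfies the triangle inequality, so neighbouring states suffice. A pair
  of neighbours whose lower element has level \<open>s\<close> merges with probability \<open>1/N\<close> in each step, and can
  split into two such pairs only at level \<open>R\<close>, which the upward drift leaves quickly. The weight
  \<open>1 + (1/5) (1/3)^(s - R)\<close> makes up for the splitting: its expectation decreases by a factor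
  \<open>1 - 1/(2N)\<close> in each step. Hence \<open>1 - \<kappa>\<^sub>k \<le> 6/5 (1 - 1/(2N))^k\<close>, which implies both bounds.
\<close>

section \<open>Random mapping representations\<close>

text \<open>Expected cost when both chains follow one common sequence of uniform moves. The
  recursion peels off the first move, so the properties of \<open>d\<close> pass to every
  \<open>k\<close> by averaging over moves.\<close>

primrec coupled_dist ::
  "'m set \<Rightarrow> ('m \<Rightarrow> 'a \<Rightarrow> 'a) \<Rightarrow> ('a \<Rightarrow> 'a \<Rightarrow> real) \<Rightarrow> nat \<Rightarrow> 'a \<Rightarrow> 'a \<Rightarrow> real" where
  "coupled_dist A f d 0 x y = d x y"
| "coupled_dist A f d (Suc k) x y = (\<Sum>m\<in>A. coupled_dist A f d k (f m x) (f m y)) / real (card A)"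

text \<open>The joint law whose expected cost is \<open>coupled_dist\<close>; it serves only as a
  witness in the infimum defining \<open>wasserstein1\<close>.\<close>

primrec coupled_pmf :: "'m set \<Rightarrow> ('m \<Rightarrow> 'a \<Rightarrow> 'a) \<Rightarrow> nat \<Rightarrow> 'a \<Rightarrow> 'a \<Rightarrow> ('a \<times> 'a) pmf" where
  "coupled_pmf A f 0 x y = return_pmf (x, y)"
| "coupled_pmf A f (Suc k) x y =
     bind_pmf (pmf_of_set A) (\<lambda>m. coupled_pmf A f k (f m x) (f m y))"

lemma coupled_dist_refl:
  assumes "\<And>x. d x x = 0"
  shows "coupled_dist A f d k x x = 0"
  by (induction k arbitrary: x) (auto simp: assms)

lemma coupled_dist_commute:
  assumes "\<And>x y. d x y = d y x"
  shows "coupled_dist A f d k x y = coupled_dist A f d k y x"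
proof (induction k arbitrary: x y)
  case 0
  show ?case by (simp add: assms)
next
  case (Suc k)
  have "(\<Sum>m\<in>A. coupled_dist A f d k (f m x) (f m y)) =
        (\<Sum>m\<in>A. coupled_dist A f d k (f m y) (f m x))"
    by (intro sum.cong refl Suc)
  then show ?case by simp
qed

text \<open>One move sequence drives all three starting points, so the inequality holds sequence by
  sequence and no couplings have to be glued.\<close>

lemma coupled_dist_triangle:
  assumes "\<And>x y z. d x z \<le> d x y + d y z"
  shows "coupled_dist A f d k x z \<le> coupled_dist A f d k x y + coupled_dist A f d k y z"
proof (induction k arbitrary: x y z)
  case 0
  show ?case by (simp add: assms)
next
  case (Suc k)
  have "(\<Sum>m\<in>A. coupled_dist A f d k (f m x) (f m z)) \<le>
        (\<Sum>m\<in>A. coupled_dist A f d k (f m x) (f m y) + coupled_dist A f d k (f m y) (f m z))"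
    by (intro sum_mono Suc)
  then show ?case
    by (simp add: sum.distrib divide_right_mono flip: add_divide_distrib)
qed

text \<open>\<open>kernel_power\<close> appends its new step at the end, while the coupled
  recursions split off the first one; this reconciles the two.\<close>

lemma kernel_power_Suc_first: "kernel_power P (Suc k) x = bind_pmf (P x) (kernel_power P k)"
proof (induction k)
  case 0
  show ?case by (simp add: bind_return_pmf bind_return_pmf')
next
  case (Suc k)
  have "kernel_power P (Suc (Suc k)) x = bind_pmf (bind_pmf (P x) (kernel_power P k)) P"
    using Suc by simp
  also have "\<dots> = bind_pmf (P x) (\<lambda>x. kernel_power P (Suc k) x)"
    by (simp only: bind_assoc_pmf kernel_power.simps)
  finally show ?case .
qed

context
  fixes S :: "'a set" and A :: "'m set" and f :: "'m \<Rightarrow> 'a \<Rightarrow> 'a" and P :: "'a \<Rightarrow> 'a pmf"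
  assumes A: "finite A" "A \<noteq> {}"
    and f: "\<And>m x. m \<in> A \<Longrightarrow> x \<in> S \<Longrightarrow> f m x \<in> S"
    and P: "\<And>x. x \<in> S \<Longrightarrow> P x = map_pmf (\<lambda>m. f m x) (pmf_of_set A)"
begin

lemma coupled_pmf_in_couplings:
  assumes "x \<in> S" "y \<in> S"
  shows "coupled_pmf A f k x y \<in> couplings (kernel_power P k x) (kernel_power P k y)"
proof -
  have "map_pmf fst (coupled_pmf A f k x y) = kernel_power P k x \<and>
        map_pmf snd (coupled_pmf A f k x y) = kernel_power P k y"
    using assms
  proof (induction k arbitrary: x y)
    case 0
    then show ?case by simp
  next
    case (Suc k)
    have "map_pmf fst (coupled_pmf A f (Suc k) x y) =
        bind_pmf (pmf_of_set A) (\<lambda>m. kernel_power P k (f m x))"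
      unfolding coupled_pmf.simps map_bind_pmf
      using Suc f A by (intro bind_pmf_cong) auto
    moreover have "map_pmf snd (coupled_pmf A f (Suc k) x y) =
        bind_pmf (pmf_of_set A) (\<lambda>m. kernel_power P k (f m y))"
      unfolding coupled_pmf.simps map_bind_pmf
      using Suc f A by (intro bind_pmf_cong) auto
    ultimately show ?case
      unfolding kernel_power_Suc_first using Suc.prems by (simp add: P bind_map_pmf)
  qed
  then show ?thesis by (simp add: couplings_def)
qed

lemma finite_set_coupled_pmf: "finite (set_pmf (coupled_pmf A f k x y))"
  using A by (induction k arbitrary: x y) auto

lemma expectation_coupled_pmf:
  "measure_pmf.expectation (coupled_pmf A f k x y) (\<lambda>(x, y). d x y) = coupled_dist A f d k x y"
proof (induction k arbitrary: x y)
  case 0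
  show ?case by simp
next
  case (Suc k)
  show ?case
    using A by (simp add: pmf_expectation_bind_pmf_of_set finite_set_coupled_pmf Suc sum_distrib_left
        divide_inverse_commute)
qed

lemma wasserstein1_le_coupled_dist:
  assumes "x \<in> S" "y \<in> S" and d: "\<And>x y. d x y \<ge> 0"
  shows "wasserstein1 d (kernel_power P k x) (kernel_power P k y) \<le> coupled_dist A f d k x y"
  unfolding wasserstein1_def
proof (rule cINF_lower2[OF _ coupled_pmf_in_couplings[OF assms(1,2)]])
  \<comment> \<open>A real infimum lies below its members only if the set is bounded below; zero is
    a bound because \<open>d\<close> is nonnegative.\<close>
  show "bdd_below ((\<lambda>q. measure_pmf.expectation q (\<lambda>(x, y). d x y)) `
      couplings (kernel_power P k x) (kernel_power P k y))"
    by (intro bdd_belowI[of _ 0]) (auto intro!: Bochner_Integration.integral_nonneg simp: d)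
qed (simp add: expectation_coupled_pmf)

end

section \<open>The walk on the cube\<close>

abbreviation level :: "nat \<Rightarrow> (nat \<Rightarrow> nat) \<Rightarrow> nat" where
  "level N x \<equiv> (\<Sum>i=1..N. x i)"

text \<open>Coordinate and bit form one move, so a single draw acts on all states at once. On
  \<open>cube_states\<close> the level is at least \<open>R\<close>, so there the test agrees with
  that of \<open>cube_walk\<close>.\<close>

definition cube_move :: "nat \<Rightarrow> nat \<Rightarrow> nat \<times> bool \<Rightarrow> (nat \<Rightarrow> nat) \<Rightarrow> (nat \<Rightarrow> nat)" where
  "cube_move N R = (\<lambda>(i, b) x. if level N x > R \<or> x i = 0 then x(i := of_bool b) else x)"

abbreviation cube_dist :: "nat \<Rightarrow> nat \<Rightarrow> nat \<Rightarrow> (nat \<Rightarrow> nat) \<Rightarrow> (nat \<Rightarrow> nat) \<Rightarrow> real" where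
  "cube_dist N R \<equiv> coupled_dist ({1..N} \<times> UNIV) (cube_move N R) (hamming_dist N)"

lemma cube_statesD:
  assumes "x \<in> cube_states N R"
  shows "level N x \<ge> R" "i \<in> {1..N} \<Longrightarrow> x i = 0 \<or> x i = 1" "i \<notin> {1..N} \<Longrightarrow> x i = undefined"
  using assms unfolding cube_states_def PiE_def extensional_def by auto

text \<open>Stated additively to avoid truncated subtraction when the coordinate drops.\<close>

lemma level_upd:
  assumes "i \<in> {1..N}"
  shows "level N (x(i := c)) + x i = level N x + c"
proof -
  have "(\<Sum>j\<in>{1..N} - {i}. (x(i := c)) j) = (\<Sum>j\<in>{1..N} - {i}. x j)"
    by (intro sum.cong) auto
  then show ?thesis
    using assms sum.remove[of "{1..N}" i "x(i := c)"] sum.remove[of "{1..N}" i x] by simp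
qed

lemma cube_states_upd:
  assumes "x \<in> cube_states N R" "i \<in> {1..N}" "c \<in> {0, 1}" "R + x i \<le> level N x + c"
  shows "x(i := c) \<in> cube_states N R"
proof -
  have "x(i := c) \<in> {1..N} \<rightarrow>\<^sub>E {0, 1}"
    using assms(1-3)
    unfolding cube_states_def PiE_def extensional_def Pi_def by auto
  moreover have "level N (x(i := c)) \<ge> R"
    using level_upd[OF assms(2), of x c] assms(4) by linarith
  ultimately show ?thesis unfolding cube_states_def by simp
qed

lemma cube_move_in_cube_states:
  assumes "m \<in> {1..N} \<times> UNIV" "x \<in> cube_states N R"
  shows "cube_move N R m x \<in> cube_states N R"
proof -
  obtain i b where m: "m = (i, b)" "i \<in> {1..N}" using assms by auto
  have "R + x i \<le> level N x + of_bool b" if "level N x > R \<or> x i = 0"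
    using that cube_statesD(1)[OF assms(2)] cube_statesD(2)[OF assms(2) m(2)] by auto
  then show ?thesis
    using assms(2) m by (auto simp: cube_move_def intro!: cube_states_upd)
qed

text \<open>A fair Bernoulli bit is uniform on the booleans, so an independent coordinate and bit
  amount to a uniform draw from the product set.\<close>

lemma cube_walk_eq_cube_move:
  assumes "N \<ge> 1" "x \<in> cube_states N R"
  shows "cube_walk N R x = map_pmf (\<lambda>m. cube_move N R m x) (pmf_of_set ({1..N} \<times> UNIV))"
proof -
  have "pmf_of_set ({1..N} \<times> (UNIV :: bool set)) = pair_pmf (pmf_of_set {1..N}) (pmf_of_set UNIV)"
    using assms(1) by (intro pmf_eqI) (auto simp: pmf_pair indicator_def card_cartesian_product)
  then have "map_pmf (\<lambda>m. cube_move N R m x) (pmf_of_set ({1..N} \<times> UNIV)) =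
      bind_pmf (pmf_of_set {1..N}) (\<lambda>i. map_pmf (\<lambda>b. cube_move N R (i, b) x) (bernoulli_pmf (1/2)))"
    unfolding bernoulli_pmf_half_conv_pmf_of_set
    by (simp only: pair_pmf_def map_pmf_def bind_assoc_pmf bind_return_pmf)
  also have "\<dots> = cube_walk N R x"
    unfolding cube_walk_def
    using cube_statesD(1)[OF assms(2)] by (intro bind_pmf_cong) (auto simp: cube_move_def)
  finally show ?thesis by simp
qed

section \<open>The Hamming distance and its coupled version\<close>

lemma hamming_dist_nonneg: "hamming_dist N x y \<ge> 0"
  unfolding hamming_dist_def by (simp add: sum_nonneg)

lemma hamming_dist_refl: "hamming_dist N x x = 0"
  unfolding hamming_dist_def by simp

lemma hamming_dist_commute: "hamming_dist N x y = hamming_dist N y x"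
  unfolding hamming_dist_def by (intro sum.cong) auto

lemma hamming_dist_triangle: "hamming_dist N x z \<le> hamming_dist N x y + hamming_dist N y z"
  unfolding hamming_dist_def sum.distrib[symmetric] by (intro sum_mono) auto

lemma hamming_dist_upd:
  assumes "i \<in> {1..N}" "x i \<noteq> y i"
  shows "hamming_dist N x y = 1 + hamming_dist N (x(i := y i)) y"
proof -
  have "(\<Sum>j\<in>{1..N} - {i}. of_bool ((x(i := y i)) j \<noteq> y j)) =
      (\<Sum>j\<in>{1..N} - {i}. of_bool (x j \<noteq> y j) :: real)"
    by (intro sum.cong) auto
  moreover have "hamming_dist N z y =
      of_bool (z i \<noteq> y i) + (\<Sum>j\<in>{1..N} - {i}. of_bool (z j \<noteq> y j))" for z
    unfolding hamming_dist_def using assms(1) by (intro sum.remove) auto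
  ultimately show ?thesis
    using assms(2) by (simp del: sum_of_bool_eq)
qed

lemma hamming_dist_pos:
  assumes "x \<in> cube_states N R" "y \<in> cube_states N R" "x \<noteq> y"
  shows "hamming_dist N x y > 0"
proof -
  obtain i where i: "x i \<noteq> y i" using assms(3) by blast
  then have "i \<in> {1..N}" using assms(1,2) cube_statesD(3) by metis
  then show ?thesis
    using hamming_dist_upd[of i N x y] i hamming_dist_nonneg[of N "x(i := y i)" y] by simp
qed

lemma cube_dist_refl: "cube_dist N R k x x = 0"
  by (rule coupled_dist_refl[OF hamming_dist_refl])

lemma cube_dist_commute: "cube_dist N R k x y = cube_dist N R k y x"
  by (rule coupled_dist_commute[OF hamming_dist_commute])

lemma cube_dist_triangle: "cube_dist N R k x z \<le> cube_dist N R k x y + cube_dist N R k y z"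
  by (rule coupled_dist_triangle[OF hamming_dist_triangle])

section \<open>Level weights and the contraction of neighbouring pairs\<close>

definition weight :: "nat \<Rightarrow> real" where
  "weight t = 1 + (1/5) * (1/3) ^ t"

lemma weight_ge_1: "weight t \<ge> 1"
  unfolding weight_def by simp

lemma weight_le: "weight t \<le> 6/5"
  unfolding weight_def using power_le_one[of "1/3 :: real" t] by simp

text \<open>The next two lemmas bound the sum of the weights over the \<open>2N\<close> possible moves, where a pair
  at level \<open>R\<close> counts twice after a split.\<close>

lemma weight_drift_interior:
  fixes N R t :: nat
  assumes "10 * R \<le> N"
  shows "(real N - 1 - real (R + Suc t)) * (weight (Suc t) + weight (Suc (Suc t)))
      + real (R + Suc t) * (weight (Suc t) + weight t) \<le> (2 * real N - 1) * weight (Suc t)"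
proof -
  \<comment> \<open>\<open>h\<close> is the excess of the weight over 1 at level
    \<open>R + Suc t\<close>; one level up it is \<open>h / 3\<close>, one level down
    \<open>3 * h\<close>. The claim expands to
    \<open>8/3 * (R + t + 1) * h \<le> 1 + 2/3 * N * h + h/3\<close>. The geometric decay of
    \<open>h\<close> handles the part with \<open>t + 1\<close>, and \<open>4 * R \<le> N\<close>
    the part with \<open>R\<close>.\<close>
  define h :: real where "h = (1/5) * (1/3) ^ Suc t"
  have h0: "h \<ge> 0" unfolding h_def by simp
  have "real (Suc t) \<le> 3 ^ Suc t"
    using of_nat_less_two_power[of "Suc t", where 'a = real] power_mono[of "2::real" 3 "Suc t"] by linarith
  then have th: "real (Suc t) * h \<le> 1/5"
    unfolding h_def by (simp add: power_divide field_simps del: power_Suc of_nat_Suc)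
  have "(4 * real R) * h \<le> real N * h"
    using assms h0 by (intro mult_right_mono) linarith+
  moreover have w: "weight (Suc t) = 1 + h" "weight (Suc (Suc t)) = 1 + h / 3" "weight t = 1 + 3 * h"
    unfolding weight_def h_def by simp_all
  ultimately show ?thesis
    using th h0 unfolding w by (simp add: field_simps)
qed

lemma weight_drift_boundary:
  fixes N R :: nat
  assumes "10 * R \<le> N"
  shows "(real N - 1 - real R) * (weight 0 + weight (Suc 0)) + real R * (3 * weight 0)
      \<le> (2 * real N - 1) * weight 0"
  \<comment> \<open>Multiplied by 15, the claim is \<open>20 * R \<le> 2 * N + 16\<close>. With
    ratio 1/3, the coefficient 1/5 in \<open>weight\<close> is the smallest for which the inequality
    survives at \<open>R = N/10\<close> for arbitrarily large \<open>N\<close>.\<close>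
  using assms unfolding weight_def by (simp add: field_simps)

text \<open>First-step analysis over the \<open>2 * N\<close> moves: each resulting pair is again
  adjacent, equal, or joined by two adjacent pairs. The drift inequalities bound the total weight by
  \<open>2 * N - 1\<close> times the old one.\<close>

lemma cube_dist_adjacent:
  assumes N: "N \<ge> 1" and R: "10 * R \<le> N"
    and "x \<in> cube_states N R" "j \<in> {1..N}" "x j = 0"
  shows "cube_dist N R k x (x(j := 1)) \<le> (1 - 1 / (2 * real N)) ^ k * weight (level N x - R)"
  using assms(3-)
proof (induction k arbitrary: x j)
  case 0
  have "hamming_dist N x (x(j := 1)) = 1"
    using hamming_dist_upd[of j N x "x(j := 1)"] 0 hamming_dist_refl[of N "x(j := 1)"] by simp
  then show ?case
    using weight_ge_1[of "level N x - R"] by (simp only: coupled_dist.simps power_0 mult_1)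
next
  case (Suc k)
  define \<beta> where "\<beta> = (1 - 1 / (2 * real N)) ^ k"
  have \<beta>: "\<beta> \<ge> 0" using N unfolding \<beta>_def by (simp add: field_simps)
  define y where "y = x(j := 1)"
  define s where "s = level N x"
  define W where "W t = weight (t - R)" for t
  \<comment> \<open>Total weight of the two moves at a coordinate where \<open>x\<close> is 1. At
    level \<open>R\<close>, bit 1 keeps the pair, and bit 0 splits it in two, hence three
    weights.\<close>
  define c where "c = (if s > R then W s + W (s - 1) else 3 * W R)"
  let ?D = "cube_dist N R k"
  note x = cube_statesD[OF Suc.prems(1)]
  have sR: "s \<ge> R" using x(1) by (simp add: s_def)
  have ly: "level N y = s + 1"
    using level_upd[OF Suc.prems(2), of x 1] Suc.prems(3) by (simp add: s_def y_def)
  have y_in: "y \<in> cube_states N R"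
    unfolding y_def using Suc.prems sR by (intro cube_states_upd) (auto simp: s_def)
  have IH: "?D z (z(i := 1)) \<le> \<beta> * W (level N z)"
    if "z \<in> cube_states N R" "i \<in> {1..N}" "z i = 0" for z i
    unfolding \<beta>_def W_def by (rule Suc.IH[OF that])
  have moves: "(\<Sum>b\<in>UNIV. ?D (cube_move N R (i, b) x) (cube_move N R (i, b) y)) \<le>
      \<beta> * (if i = j then 0 else if x i = 0 then W s + W (s + 1) else c)" (is "?L \<le> _")
    if i: "i \<in> {1..N}" for i
  proof -
    have L: "?L = ?D (cube_move N R (i, True) x) (cube_move N R (i, True) y)
        + ?D (cube_move N R (i, False) x) (cube_move N R (i, False) y)"
      by (simp add: UNIV_bool)
    \<comment> \<open>The upper state has level \<open>s + 1 > R\<close>, so only \<open>x\<close>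
      can ever be blocked.\<close>
    have my: "cube_move N R (i, b) y = y(i := of_bool b)" for b
      using ly sR by (simp add: cube_move_def)
    \<comment> \<open>In turn: the pair merges; it stays or rises one level; it stays or falls one
      level; \<open>x\<close> is blocked and the pair may split.\<close>
    consider "i = j" | "i \<noteq> j" "x i = 0" | "i \<noteq> j" "x i = 1" "s > R" | "i \<noteq> j" "x i = 1" "s = R"
      using x(2)[OF i] sR by linarith
    then show ?thesis
    proof cases
      case 1
      have mx: "cube_move N R (i, b) x = x(i := of_bool b)" for b
        using 1 Suc.prems(3) by (simp add: cube_move_def)
      show ?thesis
        using 1 unfolding L unfolding my mx
        by (simp add: y_def cube_dist_refl del: One_nat_def)
    next
      case 2
      have mx: "cube_move N R (i, b) x = x(i := of_bool b)" for b
        using 2 by (simp add: cube_move_def)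
      have "?D (x(i := b)) (y(i := b)) \<le> \<beta> * W (s + b)" if b: "b \<in> {0, 1}" for b
      proof -
        have "level N (x(i := b)) = s + b"
          using level_upd[OF i, of x b] 2 by (simp add: s_def)
        moreover have "y(i := b) = (x(i := b))(j := 1)"
          using 2 by (auto simp: y_def)
        moreover have "x(i := b) \<in> cube_states N R"
          using Suc.prems(1) i b 2 sR by (intro cube_states_upd) (auto simp: s_def)
        ultimately show ?thesis
          using IH[of "x(i := b)" j] 2 Suc.prems by simp
      qed
      from this[of 0] this[of 1] show ?thesis
        using 2 unfolding L unfolding my mx by (simp add: algebra_simps)
    next
      case 3
      have mx: "cube_move N R (i, b) x = x(i := of_bool b)" for b
        using 3 by (simp add: cube_move_def s_def)
      \<comment> \<open>The subtraction in \<open>s - 1 + b\<close> is genuine because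
        \<open>s > R\<close>.\<close>
      have "?D (x(i := b)) (y(i := b)) \<le> \<beta> * W (s - 1 + b)" if b: "b \<in> {0, 1}" for b
      proof -
        have "level N (x(i := b)) = s - 1 + b"
          using level_upd[OF i, of x b] 3 by (simp add: s_def)
        moreover have "y(i := b) = (x(i := b))(j := 1)"
          using 3 by (auto simp: y_def)
        moreover have "x(i := b) \<in> cube_states N R"
          using Suc.prems(1) i b 3 by (intro cube_states_upd) (auto simp: s_def)
        ultimately show ?thesis
          using IH[of "x(i := b)" j] 3 Suc.prems by simp
      qed
      from this[of 0] this[of 1] show ?thesis
        using 3 unfolding L unfolding my mx by (simp add: algebra_simps c_def)
    next
      case 4
      \<comment> \<open>With bit 0, \<open>x\<close> stays and \<open>y\<close> moves to
        \<open>?z\<close>, at Hamming distance two from \<open>x\<close>. The path between them goes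
        up through \<open>y\<close>: their common lower neighbour has level \<open>R - 1\<close> and
        is forbidden. Both halves have lower level \<open>R\<close>.\<close>
      let ?z = "y(i := 0)"
      have mx: "cube_move N R (i, b) x = x" for b
        using 4 by (simp add: cube_move_def s_def)
      have yi: "y i = 1" using 4 by (simp add: y_def)
      then have "y(i := 1) = y" by auto
      have xy: "?D x y \<le> \<beta> * W R"
        using IH[OF Suc.prems] 4 by (simp add: y_def s_def)
      have z_in: "?z \<in> cube_states N R"
        using y_in i yi ly sR by (intro cube_states_upd) auto
      have "level N ?z = R"
        using level_upd[OF i, of y 0] yi ly 4 by simp
      then have zy: "?D ?z y \<le> \<beta> * W R"
        using IH[OF z_in i] \<open>y(i := 1) = y\<close> by simp
      have "?D x ?z \<le> ?D x y + ?D y ?z"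
        by (rule cube_dist_triangle)
      moreover have "?D y ?z = ?D ?z y"
        by (rule cube_dist_commute)
      ultimately show ?thesis
        using 4 xy zy \<open>y(i := 1) = y\<close> unfolding L unfolding my mx by (simp add: c_def)
    qed
  qed
  have sum_g: "(\<Sum>i=1..N. if i = j then 0 else if x i = 0 then W s + W (s + 1) else c) =
      (real N - 1 - real s) * (W s + W (s + 1)) + real s * c" (is "?G = _")
  proof -
    let ?u = "W s + W (s + 1)"
    \<comment> \<open>Since entries are 0 or 1, \<open>real (x i)\<close> acts as an indicator.
      Besides \<open>j\<close>, which is 0 in \<open>x\<close>, there are \<open>N - 1 - s\<close>
      zeros and \<open>s\<close> ones.\<close>
    have "?G = (\<Sum>i=1..N. ?u - (if i = j then ?u else 0) + real (x i) * (c - ?u))"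
    proof (intro sum.cong refl)
      fix i assume "i \<in> {1..N}"
      from x(2)[OF this] show "(if i = j then 0 else if x i = 0 then ?u else c) =
          ?u - (if i = j then ?u else 0) + real (x i) * (c - ?u)"
        using Suc.prems(3) by auto
    qed
    also have "\<dots> = real N * ?u - ?u + real s * (c - ?u)"
      unfolding sum.distrib sum_subtractf sum_distrib_right[symmetric]
      using Suc.prems(2) by (simp add: s_def distrib_left)
    finally show ?thesis by (simp add: algebra_simps)
  qed
  have drift: "?G \<le> (2 * real N - 1) * W s"
  proof (cases "s = R")
    case True
    then show ?thesis
      using weight_drift_boundary[OF R] unfolding sum_g by (simp add: c_def W_def Suc_diff_le)
  next
    case False
    then obtain t where t: "s = R + Suc t"
      using sR less_imp_Suc_add[of R s] by auto
    show ?thesis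
      using weight_drift_interior[OF R, of t] unfolding sum_g by (simp add: t c_def W_def Suc_diff_le)
  qed
  have "(\<Sum>m\<in>{1..N} \<times> UNIV. ?D (cube_move N R m x) (cube_move N R m y)) =
      (\<Sum>i=1..N. \<Sum>b\<in>UNIV. ?D (cube_move N R (i, b) x) (cube_move N R (i, b) y))"
    by (simp add: sum.cartesian_product)
  also have "\<dots> \<le> (\<Sum>i=1..N. \<beta> * (if i = j then 0 else if x i = 0 then W s + W (s + 1) else c))"
    by (intro sum_mono moves)
  also have "\<dots> \<le> \<beta> * ((2 * real N - 1) * W s)"
    unfolding sum_distrib_left[symmetric] by (rule mult_left_mono[OF drift \<beta>])
  finally have "cube_dist N R (Suc k) x y \<le> \<beta> * ((2 * real N - 1) * W s) / (2 * real N)"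
    by (simp add: card_cartesian_product divide_right_mono mult.commute)
  also have "\<dots> = \<beta> * ((2 * real N - 1) / (2 * real N)) * W s"
    by simp
  also have "(2 * real N - 1) / (2 * real N) = 1 - 1 / (2 * real N)"
    using N by (simp add: diff_divide_distrib)
  also have "\<beta> * (1 - 1 / (2 * real N)) * W s = (1 - 1 / (2 * real N)) ^ Suc k * W s"
    by (simp only: \<beta>_def power_Suc mult.commute)
  finally show ?case by (simp add: y_def W_def s_def)
qed

text \<open>Path coupling: the triangle inequality adds the neighbour bounds along a shortest path
  inside the cube, and the uniform bound 6/5 on the weights removes the dependence on the
  level.\<close>

lemma cube_dist_le:
  assumes N: "N \<ge> 1" and R: "10 * R \<le> N"
    and "x \<in> cube_states N R" "y \<in> cube_states N R"
  shows "cube_dist N R k x y \<le> 6/5 * (1 - 1 / (2 * real N)) ^ k * hamming_dist N x y"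
proof -
  define K where "K = 6/5 * (1 - 1 / (2 * real N)) ^ k"
  have adj: "cube_dist N R k z (z(i := 1)) \<le> K"
    if "z \<in> cube_states N R" "i \<in> {1..N}" "z i = 0" for z i
  proof -
    have nonneg: "(1 - 1 / (2 * real N)) ^ k \<ge> 0" using N by (simp add: field_simps)
    have "(1 - 1 / (2 * real N)) ^ k * weight (level N z - R) \<le> K"
      using mult_left_mono[OF weight_le nonneg] by (simp only: K_def mult.commute)
    then show ?thesis using cube_dist_adjacent[OF N R that, of k] by linarith
  qed
  text \<open>Raising coordinates keeps the path inside the cube, so of two
    coordinates that differ the smaller one is changed.\<close>
  have "cube_dist N R k x y \<le> K * hamming_dist N x y" if "hamming_dist N x y = real n" for n
    using assms(3,4) that
  proof (induction n arbitrary: x y)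
    case 0
    then have "x = y" using hamming_dist_pos by force
    then show ?case by (simp add: cube_dist_refl hamming_dist_refl del: One_nat_def)
  next
    case (Suc n)
    \<comment> \<open>Stated for general \<open>z\<close> and \<open>v\<close>, so that symmetry
      covers both choices of the endpoint to be raised.\<close>
    have step: "cube_dist N R k z v \<le> K * hamming_dist N z v"
      if zv: "z \<in> cube_states N R" "v \<in> cube_states N R" "hamming_dist N z v = real (Suc n)"
        and i: "i \<in> {1..N}" "z i = 0" "v i = 1" for z v i
    proof -
      have up: "z(i := 1) \<in> cube_states N R"
        using zv(1) i cube_statesD(1)[OF zv(1)] by (intro cube_states_upd) auto
      have d: "hamming_dist N z v = 1 + hamming_dist N (z(i := 1)) v"
        using hamming_dist_upd[of i N z v] i by simp
      then have "hamming_dist N (z(i := 1)) v = real n" using zv(3) by simp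
      from Suc.IH[OF up zv(2) this] show ?thesis
        using adj[OF zv(1) i(1,2)] cube_dist_triangle[of N R k z v "z(i := 1)"]
        unfolding d by (simp only: distrib_left mult_1_right)
    qed
    have "x \<noteq> y" using Suc.prems hamming_dist_refl[of N y] by auto
    then obtain i where i: "x i \<noteq> y i" by blast
    then have "i \<in> {1..N}" using Suc.prems(1,2) cube_statesD(3) by metis
    moreover from this have "x i = 0 \<and> y i = 1 \<or> y i = 0 \<and> x i = 1"
      using i cube_statesD(2)[OF Suc.prems(1), of i] cube_statesD(2)[OF Suc.prems(2), of i] by auto
    ultimately show ?case
      using step[of x y i] step[of y x i] Suc.prems
      by (auto simp: hamming_dist_commute[of N y x] cube_dist_commute[of N R k y x] simp del: One_nat_def)
  qed
  moreover have "hamming_dist N x y = real (\<Sum>i=1..N. of_bool (x i \<noteq> y i))"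
    unfolding hamming_dist_def by simp
  ultimately show ?thesis unfolding K_def by blast
qed

section \<open>From the coupling to curvature bounds\<close>

lemma cube_states_nonempty:
  assumes "R \<le> N"
  shows "cube_states N R \<noteq> {}"
proof -
  have "restrict (\<lambda>_. 1) {1..N} \<in> cube_states N R"
    using assms unfolding cube_states_def by simp
  then show ?thesis by blast
qed

lemma curvature_at_ge:
  assumes "N \<ge> 1" "10 * R \<le> N" "x \<in> cube_states N R" "y \<in> cube_states N R"
  shows "curvature_at (hamming_dist N) (cube_walk N R) k x y \<ge> 1 - 6/5 * (1 - 1 / (2 * real N)) ^ k"
proof (cases "x = y")
  case True
  then show ?thesis using assms(1) by (simp add: curvature_at_def field_simps)
next
  case False
  have "wasserstein1 (hamming_dist N) (kernel_power (cube_walk N R) k x)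
      (kernel_power (cube_walk N R) k y) \<le> cube_dist N R k x y"
    using assms
    by (intro wasserstein1_le_coupled_dist[where S = "cube_states N R"] hamming_dist_nonneg
        cube_move_in_cube_states cube_walk_eq_cube_move) auto
  also note cube_dist_le[OF assms]
  finally show ?thesis
    using False hamming_dist_pos[OF assms(3,4) False] by (simp add: curvature_at_def pos_divide_le_eq)
qed

lemma cube_curvature_ge:
  assumes "N \<ge> 1" "10 * R \<le> N"
  shows "cube_curvature N R k \<ge> 1 - 6/5 * (1 - 1 / (2 * real N)) ^ k"
  unfolding curvature_def
proof (rule cINF_greatest)
  show "cube_states N R \<times> cube_states N R \<noteq> {}"
    using cube_states_nonempty[of R N] assms by simp
qed (use curvature_at_ge[OF assms] in auto)

text \<open>A diagonal pair has curvature 1. This makes the terms of the cumulative series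
  nonnegative, as the termwise comparison requires.\<close>

lemma cube_curvature_le_1:
  assumes "N \<ge> 1" "10 * R \<le> N"
  shows "cube_curvature N R k \<le> 1"
proof -
  obtain x where x: "x \<in> cube_states N R" using cube_states_nonempty[of R N] assms by auto
  have "bdd_below ((\<lambda>(x, y). curvature_at (hamming_dist N) (cube_walk N R) k x y) `
      (cube_states N R \<times> cube_states N R))"
    using assms by (intro bdd_belowI2) (auto intro!: curvature_at_ge)
  then have "cube_curvature N R k \<le> (case (x, x) of (x, y) \<Rightarrow>
      curvature_at (hamming_dist N) (cube_walk N R) k x y)"
    unfolding curvature_def using x by (intro cINF_lower) auto
  then show ?thesis by (simp add: curvature_at_def)
qed

section \<open>Numerical estimates\<close>

lemma rho_bounds:
  assumes "N \<ge> 1" "10 * R \<le> N"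
  shows "0 < rho N R" "rho N R \<le> 1/6" "rho N R \<le> 1/2 - 1 / exp 1"
proof -
  \<comment> \<open>The target is \<open>exp 1 > 8/3\<close>: then \<open>1 / exp 1 < 3/8\<close>,
    and with \<open>R / (N - 2 * R) \<le> 1/8\<close> this makes \<open>rho\<close> positive. The
    quadratic Taylor bound is applied at 1/4 and raised to the fourth power, as at 1 it gives only
    5/2.\<close>
  have "exp (1/4 :: real) \<ge> 41/32"
    using exp_lower_Taylor_quadratic[of "1/4 :: real"] by (simp add: power2_eq_square)
  then have "exp (1/4 :: real) ^ 4 \<ge> (41/32) ^ 4"
    by (intro power_mono) auto
  moreover have "exp (1/4 :: real) ^ 4 = exp 1"
    by (simp flip: exp_of_nat_mult)
  ultimately have e: "exp (1::real) > 8/3"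
    by (simp add: power4_eq_xxxx)
  have "real R / (real N - 2 * real R) \<le> 1/8"
    using assms by (simp add: field_simps)
  moreover have "1 / exp 1 < (3/8 :: real)"
    using e by (simp add: field_simps)
  ultimately show "0 < rho N R" unfolding rho_def by linarith
  have "real R / (real N - 2 * real R) \<ge> 0"
    using assms by (simp add: field_simps)
  then show *: "rho N R \<le> 1/2 - 1 / exp 1" unfolding rho_def by linarith
  have "1 / exp 1 \<ge> (1/3 :: real)"
    using exp_le by (simp add: field_simps)
  with * show "rho N R \<le> 1/6" by linarith
qed

theorem proposition4p14:
  fixes N R :: nat
  assumes "N \<ge> 1" and "real R \<le> real N / 10"
  shows "cube_curvature N R N \<ge> rho N R
    \<and> cube_cumulative_curvature_compl N R
        \<le> ereal (real N / rho N R * (1 + real R / (real N - 2 * real R)))"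
proof
  define r where "r = 1 - 1 / (2 * real N)"
  have R: "10 * R \<le> N" using assms(2) by linarith
  note rho = rho_bounds[OF assms(1) R]
  have r: "0 \<le> r" "r < 1" using assms(1) by (simp_all add: r_def field_simps)

  define u :: real where "u = exp (- (1/2))"
  have "r ^ N \<le> exp (- (1 / (2 * real N))) ^ N"
    using r(1) exp_ge_add_one_self[of "- (1 / (2 * real N))"] by (intro power_mono) (simp_all add: r_def)
  also have "\<dots> = u"
    using assms(1) by (simp add: u_def flip: exp_of_nat_mult)
  finally have "r ^ N \<le> u" .
  moreover have "u\<^sup>2 = exp (- 1)"
    by (simp add: u_def power2_eq_square flip: exp_add)
  then have "1 / exp 1 = u\<^sup>2"
    by (simp add: exp_minus inverse_eq_divide)
  \<comment> \<open>Completing the square: \<open>u^2 - 6/5 * u + 1/2 = (u - 3/5)^2 + 7/50\<close>,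
    hence \<open>1/2 - u^2 \<le> 1 - 6/5 * u\<close>, where \<open>u^2\<close> is
    \<open>1 / exp 1\<close>.\<close>
  moreover have "(u - 3/5)\<^sup>2 \<ge> 0" by simp
  ultimately have "rho N R \<le> 1 - 6/5 * r ^ N"
    using rho(3) by (simp add: power2_eq_square algebra_simps)
  then show "cube_curvature N R N \<ge> rho N R"
    using cube_curvature_ge[OF assms(1) R, of N] by (simp add: r_def)

  have "(\<lambda>k. 6/5 * r ^ k) sums (6/5 * (1 / (1 - r)))"
    using r by (intro sums_mult geometric_sums) auto
  also have "6/5 * (1 / (1 - r)) = 12/5 * real N"
    using assms(1) by (simp add: r_def)
  finally have geom: "(\<lambda>k. ereal (6/5 * r ^ k)) sums ereal (12/5 * real N)"
    by (simp add: sums_ereal)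
  have "cube_cumulative_curvature_compl N R \<le> (\<Sum>k. ereal (6/5 * r ^ k))"
    unfolding cumulative_curvature_compl_def
  proof (rule suminf_le_pos)
    fix k
    show "ereal (1 - cube_curvature N R k) \<le> ereal (6/5 * r ^ k)"
      using cube_curvature_ge[OF assms(1) R, of k] by (simp add: r_def)
    show "0 \<le> ereal (1 - cube_curvature N R k)"
      using cube_curvature_le_1[OF assms(1) R] by simp
  qed
  also have "\<dots> = ereal (12/5 * real N)"
    using geom by (rule sums_unique[symmetric])
  also have "12/5 * real N \<le> real N / rho N R * (1 + real R / (real N - 2 * real R))"
  proof -
    \<comment> \<open>The bound \<open>rho \<le> 1/6\<close> gives even 2/5 here, so the factor
      \<open>1 + R / (N - 2 * R)\<close> only has to be at least 1.\<close>
    have "12/5 * rho N R \<le> 1" using rho by linarith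
    then have "12/5 * real N \<le> real N / rho N R * 1"
      using rho(1) mult_left_mono[of "12/5 * rho N R" 1 "real N"] by (simp add: field_simps)
    also have "\<dots> \<le> real N / rho N R * (1 + real R / (real N - 2 * real R))"
      using rho(1) R by (intro mult_left_mono) auto
    finally show ?thesis .
  qed
  finally show "cube_cumulative_curvature_compl N R
      \<le> ereal (real N / rho N R * (1 + real R / (real N - 2 * real R)))"
    by simp
qed

end
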